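(* Let $I\subset(0,\infty)$ be an interval, let $f:I\to\mathbb{R}$ be a differentiable function on the interior $I^\circ$, let $a,b\in I$ with $a<b$, and let $f'\in L[a,b]$. Let $\alpha>0$, $s\in(0,1]$ and $q\ge1$. If $|f'|^q$ is harmonically $s$-convex on $[a,b]$, then for all $x\in[a,b]$, $$|S_f(g;\alpha;x,a,b)|\le\frac{(x-a)^{\alpha+1}}{(ax)^{\alpha-1}}\Big(\lambda_1(a,x,s,q,\alpha q)|f'(x)|^q+\lambda_2(a,x,s,q,\alpha q)|f'(a)|^q\Big)^{\frac1q}+\frac{(b-x)^{\alpha+1}}{(bx)^{\alpha-1}}\Big(\lambda_3(b,x,s,q,\alpha q)|f'(x)|^q+\lambda_4(b,x,s,q,\alpha q)|f'(b)|^q\Big)^{\frac1q}.$$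
   Context: A function $h:K\to\mathbb{R}$ on an interval $K\subset(0,\infty)$ is harmonically $s$-convex ($s\in(0,1]$ fixed) if $h\left(\frac{uv}{tu+(1-t)v}\right)\le t^s h(v)+(1-t)^s h(u)$ for all $u,v\in K$, $t\in[0,1]$. With $g(u)=1/u$, $$S_f(g;\alpha;x,a,b)=\left[\left(\frac{x-a}{ax}\right)^{\alpha}+\left(\frac{b-x}{bx}\right)^{\alpha}\right]f(x)-\Gamma(\alpha+1)\left\{J_{1/x-}^{\alpha}(f\circ g)(1/b)+J_{1/x+}^{\alpha}(f\circ g)(1/a)\right\},$$ where $\Gamma$ is the Gamma function and the Riemann–Liouville fractional integrals are $J_{c+}^{\alpha}h(y)=\frac{1}{\Gamma(\alpha)}\int_c^y(y-t)^{\alpha-1}h(t)\,dt$ ($y>c$) and $J_{d-}^{\alpha}h(y)=\frac{1}{\Gamma(\alpha)}\int_y^d(t-y)^{\alpha-1}h(t)\,dt$ ($y<d$); an integral over a degenerate interval (when $x=a$ or $x=b$) is $0$. Beta function: $\beta(u,v)=\int_0^1t^{u-1}(1-t)^{v-1}dt$ for $u,v>0$. Hypergeometric function: ${}_2F_1(A,B;C;z)=\frac{1}{\beta(B,C-B)}\int_0^1t^{B-1}(1-t)^{C-B-1}(1-zt)^{-A}dt$ for $C>B>0$, $|z|<1$. Define $$\lambda_1(a,x,s,\vartheta,\rho)=\frac{\beta(\rho+s+1,1)}{x^{2\vartheta}}\,{}_2F_1\!\left(2\vartheta,\rho+s+1;\rho+s+2;1-\tfrac ax\right),$$ $$\lambda_2(a,x,s,\vartheta,\rho)=\frac{\beta(\rho+1,s+1)}{x^{2\vartheta}}\,{}_2F_1\!\left(2\vartheta,\rho+1;\rho+s+2;1-\tfrac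 ax\right),$$ $$\lambda_3(b,x,s,\vartheta,\rho)=\frac{\beta(1,\rho+s+1)}{b^{2\vartheta}}\,{}_2F_1\!\left(2\vartheta,1;\rho+s+2;1-\tfrac xb\right),$$ $$\lambda_4(b,x,s,\vartheta,\rho)=\frac{\beta(s+1,\rho+1)}{b^{2\vartheta}}\,{}_2F_1\!\left(2\vartheta,s+1;\rho+s+2;1-\tfrac xb\right).$$ $L[a,b]$ denotes the integrable functions on $[a,b]$. The derivative $f'$ is regarded as a function on $[a,b]$; if $a$ or $b$ is an endpoint of $I$, $f'$ there is the one-sided derivative. *)

theory Defs
  imports "HOL-Analysis.Analysis"
begin

definition harmonically_s_convex_on :: "real \<Rightarrow> real set \<Rightarrow> (real \<Rightarrow> real) \<Rightarrow> bool" where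
  "harmonically_s_convex_on s K h \<longleftrightarrow>
     is_interval K \<and> K \<subseteq> {0<..} \<and>
     (\<forall>u\<in>K. \<forall>v\<in>K. \<forall>t\<in>{0..1}.
        h (u * v / (t * u + (1 - t) * v)) \<le> t powr s * h v + (1 - t) powr s * h u)"

text \<open>Riemann--Liouville fractional integrals: \<open>RL_plus \<alpha> c h y\<close> is used for \<open>c \<le> y\<close> and
  \<open>RL_minus \<alpha> d h y\<close> for \<open>y \<le> d\<close>. In the degenerate cases \<open>c = y\<close> and \<open>y = d\<close> the
  integral is over a singleton, hence \<open>0\<close>.\<close>

definition RL_plus :: "real \<Rightarrow> real \<Rightarrow> (real \<Rightarrow> real) \<Rightarrow> real \<Rightarrow> real" where
  "RL_plus \<alpha> c h y = 1 / Gamma \<alpha> * (LBINT t:{c..y}. (y - t) powr (\<alpha> - 1) * h t)"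

definition RL_minus :: "real \<Rightarrow> real \<Rightarrow> (real \<Rightarrow> real) \<Rightarrow> real \<Rightarrow> real" where
  "RL_minus \<alpha> d h y = 1 / Gamma \<alpha> * (LBINT t:{y..d}. (t - y) powr (\<alpha> - 1) * h t)"

definition S_frac ::
  "(real \<Rightarrow> real) \<Rightarrow> (real \<Rightarrow> real) \<Rightarrow> real \<Rightarrow> real \<Rightarrow> real \<Rightarrow> real \<Rightarrow> real" where
  "S_frac f g \<alpha> x a b =
     (((x - a) / (a * x)) powr \<alpha> + ((b - x) / (b * x)) powr \<alpha>) * f x
     - Gamma (\<alpha> + 1) *
       (RL_minus \<alpha> (1 / x) (f \<circ> g) (1 / b) + RL_plus \<alpha> (1 / x) (f \<circ> g) (1 / a))"

text \<open>The library defines \<^const>\<open>Beta\<close> through \<^const>\<open>Gamma\<close>; for positive arguments this is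
  the Euler integral.\<close>

lemma Beta_eq_integral:
  fixes u v :: real
  assumes "u > 0" "v > 0"
  shows "Beta u v = (LBINT t:{0..1}. t powr (u - 1) * (1 - t) powr (v - 1))"
proof -
  have I: "((\<lambda>t. t powr (u - 1) * (1 - t) powr (v - 1)) has_integral Beta u v) {0..1}"
    by (rule has_integral_Beta_real[OF assms])
  have "(\<lambda>t. t powr (u - 1) * (1 - t) powr (v - 1)) absolutely_integrable_on {0..1}"
    by (rule nonnegative_absolutely_integrable_1) (use I in auto)
  then have "set_integrable lborel {0..1} (\<lambda>t. t powr (u - 1) * (1 - t) powr (v - 1))"
    unfolding set_integrable_def by (subst (asm) integrable_completion) auto
  then show ?thesis
    using I by (simp add: set_borel_integral_eq_integral(2) integral_unique)
qed

text \<open>Euler's integral representation, valid for \<open>C > B > 0\<close> and \<open>\<bar>z\<bar> < 1\<close>.\<close>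

definition hypergeometric_2F1 :: "real \<Rightarrow> real \<Rightarrow> real \<Rightarrow> real \<Rightarrow> real" where
  "hypergeometric_2F1 A B C z =
     1 / Beta B (C - B) *
     (LBINT t:{0..1}. t powr (B - 1) * (1 - t) powr (C - B - 1) * (1 - z * t) powr (- A))"

definition lambda1 :: "real \<Rightarrow> real \<Rightarrow> real \<Rightarrow> real \<Rightarrow> real \<Rightarrow> real" where
  "lambda1 a x s \<theta> \<rho> = Beta (\<rho> + s + 1) 1 / x powr (2 * \<theta>)
     * hypergeometric_2F1 (2 * \<theta>) (\<rho> + s + 1) (\<rho> + s + 2) (1 - a / x)"

definition lambda2 :: "real \<Rightarrow> real \<Rightarrow> real \<Rightarrow> real \<Rightarrow> real \<Rightarrow> real" where
  "lambda2 a x s \<theta> \<rho> = Beta (\<rho> + 1) (s + 1) / x powr (2 * \<theta>)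
     * hypergeometric_2F1 (2 * \<theta>) (\<rho> + 1) (\<rho> + s + 2) (1 - a / x)"

definition lambda3 :: "real \<Rightarrow> real \<Rightarrow> real \<Rightarrow> real \<Rightarrow> real \<Rightarrow> real" where
  "lambda3 b x s \<theta> \<rho> = Beta 1 (\<rho> + s + 1) / b powr (2 * \<theta>)
     * hypergeometric_2F1 (2 * \<theta>) 1 (\<rho> + s + 2) (1 - x / b)"

definition lambda4 :: "real \<Rightarrow> real \<Rightarrow> real \<Rightarrow> real \<Rightarrow> real \<Rightarrow> real" where
  "lambda4 b x s \<theta> \<rho> = Beta (s + 1) (\<rho> + 1) / b powr (2 * \<theta>)
     * hypergeometric_2F1 (2 * \<theta>) (s + 1) (\<rho> + s + 2) (1 - x / b)"

end

theory Submission
  imports Defs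
begin

text \<open>For \<open>c \<in> {a, b}\<close> let \<open>u\<close> be the path \<open>u t = c x / (t c + (1 - t) x)\<close> from \<open>c\<close> to \<open>x\<close>.
  Integrating the derivative of \<open>t powr \<alpha> * f (u t)\<close> over \<open>[0, 1]\<close> turns each half of \<open>S_frac\<close> into
  a multiple of the integral of \<open>t powr \<alpha> * f' (u t) / (t c + (1 - t) x)\<^sup>2\<close>. The power mean inequality
  moves the exponent \<open>q\<close> inside this integral, harmonic convexity bounds \<open>\<bar>f' (u t)\<bar> powr q\<close>, and the
  remaining kernels are the Euler integrals of the four \<open>\<lambda>\<close>s.\<close>

section \<open>Power mean inequality on the unit interval\<close>

text \<open>Convexity of \<open>y powr q\<close>: this is its tangent line bound at
  \<open>c\<close>, solved for \<open>y\<close>, with equality at \<open>y = c\<close>. In Young's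
  inequality with weights \<open>1 / q\<close> and \<open>1 - 1 / q\<close> the powers of
  \<open>c\<close> on the product side cancel.\<close>

lemma Young_powr_le:
  fixes y c q :: real
  assumes "y \<ge> 0" "c > 0" "q \<ge> 1"
  shows "y \<le> (1 / q) * (c powr (1 - q) * y powr q) + (1 - 1 / q) * c"
proof (cases "y = 0")
  case True
  then show ?thesis using assms by (simp add: field_simps)
next
  case False
  with assms have "y > 0" by simp
  have "(c powr (1 - q) * y powr q) powr (1 / q) * c powr (1 - 1 / q)
      \<le> (1 / q) * (c powr (1 - q) * y powr q) + (1 - 1 / q) * c"
    using assms \<open>y > 0\<close> by (intro Youngs_inequality_0) (auto simp: field_simps)
  moreover have "(c powr (1 - q) * y powr q) powr (1 / q) * c powr (1 - 1 / q)
      = c powr ((1 - q) * (1 / q) + (1 - 1 / q)) * y"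
    using assms \<open>y > 0\<close> by (simp add: powr_mult powr_powr powr_add)
  moreover have "(1 - q) * (1 / q) + (1 - 1 / q) = 0"
    using assms by (simp add: field_simps)
  ultimately show ?thesis using assms by simp
qed

text \<open>Young's inequality instead of Hoelder's: the majorant is integrable by assumption, so
  no measurability of \<open>\<phi>\<close> is required, only gauge integrability.\<close>
lemma abs_integral_le_powr:
  fixes \<phi> \<psi> :: "real \<Rightarrow> real"
  assumes \<phi>: "(\<phi> has_integral J) {0..1}" and \<psi>: "(\<psi> has_integral M) {0..1}"
    and le: "\<And>t. t \<in> {0..1} \<Longrightarrow> \<bar>\<phi> t\<bar> powr q \<le> \<psi> t" and q: "q \<ge> 1"
  shows "\<bar>J\<bar> \<le> M powr (1 / q)"
\<comment> \<open>Every \<open>c\<close> above \<open>M powr (1 / q)\<close> is shown to bound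
  \<open>\<bar>J\<bar>\<close>. Such a \<open>c\<close> is positive even if \<open>M = 0\<close>, as
  Young's inequality requires.\<close>
proof (rule dense_ge)
  fix c assume c: "M powr (1 / q) < c"
  have "0 \<le> \<psi> t" if "t \<in> {0..1}" for t
    using le[OF that] powr_ge_zero order_trans by blast
  then have M0: "M \<ge> 0" using has_integral_nonneg[OF \<psi>] by blast
  have c0: "c > 0" using c powr_ge_zero le_less_trans by blast
  have "(M powr (1 / q)) powr q < c powr q"
    using c q by (intro powr_less_mono2) auto
  then have Mc: "M \<le> c powr q" using M0 q by (simp add: powr_powr)
  let ?g = "\<lambda>t. (1 / q) * (c powr (1 - q) * \<psi> t) + (1 - 1 / q) * c"
  have g: "(?g has_integral (1 / q) * (c powr (1 - q) * M) + (1 - 1 / q) * c) {0..1}"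
    using has_integral_const_real[of "(1 - 1 / q) * c" 0 1]
    by (intro has_integral_add[OF has_integral_mult_right[OF has_integral_mult_right[OF \<psi>]]]) simp
  have "\<bar>\<phi> t\<bar> \<le> ?g t" if "t \<in> {0..1}" for t
  proof -
    have "\<bar>\<phi> t\<bar> \<le> (1 / q) * (c powr (1 - q) * \<bar>\<phi> t\<bar> powr q) + (1 - 1 / q) * c"
      by (rule Young_powr_le) (use c0 q in auto)
    also have "\<dots> \<le> ?g t"
      using le[OF that] q by (intro add_mono mult_left_mono) auto
    finally show ?thesis .
  qed
  then have "norm (integral {0..1} \<phi>) \<le> integral {0..1} ?g"
    using \<phi> g by (intro Henstock_Kurzweil_Integration.integral_norm_bound_integral) auto
  then have "\<bar>J\<bar> \<le> (1 / q) * (c powr (1 - q) * M) + (1 - 1 / q) * c"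
    using \<phi> g by (simp add: integral_unique)
  \<comment> \<open>The choice of \<open>c\<close> gives \<open>M \<le> c powr q\<close>, and then
    the integral of the majorant is at most \<open>c\<close>.\<close>
  also have "\<dots> \<le> (1 / q) * (c powr (1 - q) * c powr q) + (1 - 1 / q) * c"
    using Mc q by (intro add_mono mult_left_mono) auto
  also have "c powr (1 - q) * c powr q = c"
    using c0 by (simp flip: powr_add)
  also have "(1 / q) * c + (1 - 1 / q) * c = c"
    by (simp add: left_diff_distrib)
  finally show "\<bar>J\<bar> \<le> c" .
qed

section \<open>Substitutions in integrals over intervals\<close>

text \<open>The form with \<open>min\<close> and \<open>max\<close> allows \<open>d\<close> of
  either sign: with \<open>d = 1 / x - 1 / c\<close> it serves both fractional integrals, and with
  \<open>d = -1\<close> the reflection of the unit interval.\<close>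

lemma LBINT_affine_unit:
  fixes h :: "real \<Rightarrow> real"
  assumes "d \<noteq> 0"
  shows "(LBINT w:{min p (p + d)..max p (p + d)}. h w) = \<bar>d\<bar> * (LBINT t:{0..1}. h (p + d * t))"
proof -
  have "indicator {min p (p + d)..max p (p + d)} (p + d * t) = (indicator {0..1} t :: real)" for t
  proof -
    have "p + d * t \<in> {min p (p + d)..max p (p + d)} \<longleftrightarrow> t \<in> {0..1}"
    proof (cases "d > 0")
      case True
      then show ?thesis
        using mult_le_cancel_left_pos[of d 0 t] mult_le_cancel_left_pos[of d t 1] by auto
    next
      case False
      with assms have "d < 0" by simp
      then show ?thesis
        using mult_le_cancel_left_neg[of d t 0] mult_le_cancel_left_neg[of d 1 t] by auto
    qed
    then show ?thesis by (simp add: indicator_def)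
  qed
  then show ?thesis
    unfolding set_lebesgue_integral_def
    by (subst lborel_integral_real_affine[OF assms, of _ p]) simp
qed

lemma LBINT_singleton:
  fixes h :: "real \<Rightarrow> real"
  shows "(LBINT t:{p}. h t) = 0"
  unfolding set_lebesgue_integral_def
  by (rule integral_eq_zero_AE) (use AE_lborel_singleton[of p] in eventually_elim, simp)

lemma LBINT_reflect_unit:
  fixes h :: "real \<Rightarrow> real"
  shows "(LBINT t:{0..1}. h (1 - t)) = (LBINT t:{0..1}. h t)"
  using LBINT_affine_unit[of "-1" 1 h] by simp

section \<open>Integration by parts against a power of \<open>t\<close>\<close>

text \<open>For \<open>\<alpha> < 1\<close> the weight is unbounded at \<open>0\<close> but
  integrable, since \<open>\<alpha> - 1 > -1\<close>. A bound \<open>B\<close> for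
  \<open>\<phi>\<close> on the compact interval yields the integrable majorant
  \<open>B * t powr (\<alpha> - 1)\<close>.\<close>

lemma set_integrable_powr_mult_continuous:
  fixes \<phi> :: "real \<Rightarrow> real"
  assumes \<alpha>: "\<alpha> > 0" and \<phi>: "continuous_on {0..1} \<phi>"
  shows "set_integrable lborel {0..1} (\<lambda>t. t powr (\<alpha> - 1) * \<phi> t)"
proof -
  have "bounded (\<phi> ` {0..1})"
    using \<phi> compact_Icc by (intro compact_imp_bounded compact_continuous_image)
  then obtain B where B: "\<forall>t\<in>{0..1}. \<bar>\<phi> t\<bar> \<le> B"
    by (auto simp: bounded_iff)
  have "(\<lambda>t::real. t powr (\<alpha> - 1)) absolutely_integrable_on {0..1}"
    using integrable_on_powr_from_0[of "\<alpha> - 1" 1] \<alpha>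
    by (intro nonnegative_absolutely_integrable_1) auto
  then have "set_integrable lborel {0..1} (\<lambda>t. t powr (\<alpha> - 1))"
    unfolding set_integrable_def by (subst (asm) integrable_completion) auto
  then have "set_integrable lborel {0..1} (\<lambda>t. B * t powr (\<alpha> - 1))" by simp
  then show ?thesis
  proof (rule set_integrable_bound)
    \<comment> \<open>Continuity of \<open>\<phi>\<close> is known on \<open>{0..1}\<close> only, so
      measurability is obtained for its product with the indicator before the weight is multiplied
      on.\<close>
    have "set_borel_measurable borel {0..1} \<phi>"
      using \<phi> by (intro set_measurable_continuous_on) auto
    then have m: "(\<lambda>t. indicator {0..1} t * \<phi> t) \<in> borel_measurable borel"
      by (simp add: set_borel_measurable_def)
    have "(\<lambda>t. t powr (\<alpha> - 1) * (indicator {0..1} t * \<phi> t)) \<in> borel_measurable borel"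
      by (rule borel_measurable_times[OF _ m]) measurable
    then show "set_borel_measurable lborel {0..1} (\<lambda>t. t powr (\<alpha> - 1) * \<phi> t)"
      unfolding set_borel_measurable_def by (simp add: mult.left_commute)
    show "AE t in lborel. t \<in> {0..1} \<longrightarrow>
        norm (t powr (\<alpha> - 1) * \<phi> t) \<le> norm (B * t powr (\<alpha> - 1))"
    proof (intro AE_I2 impI)
      fix t :: real assume "t \<in> {0..1}"
      then have "\<bar>\<phi> t\<bar> \<le> \<bar>B\<bar>" using B by fastforce
      then show "norm (t powr (\<alpha> - 1) * \<phi> t) \<le> norm (B * t powr (\<alpha> - 1))"
        by (simp add: abs_mult mult.commute mult_right_mono)
    qed
  qed
qed

text \<open>The gauge integral integrates the full derivative of
  \<open>t powr \<alpha> * \<phi> t\<close> with no integrability assumption on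
  \<open>\<phi>'\<close>. Subtracting the Lebesgue integrable summand leaves the claim; the boundary
  term at \<open>0\<close> vanishes because \<open>0 powr \<alpha> = 0\<close>.\<close>

lemma powr_mult_derivative_has_integral:
  fixes \<phi> \<phi>' :: "real \<Rightarrow> real"
  assumes \<alpha>: "\<alpha> > 0" and cont: "continuous_on {0..1} \<phi>"
    and deriv: "\<And>t. t \<in> {0<..<1} \<Longrightarrow> (\<phi> has_real_derivative \<phi>' t) (at t)"
  shows "((\<lambda>t. t powr \<alpha> * \<phi>' t) has_integral
           \<phi> 1 - \<alpha> * (LBINT t:{0..1}. t powr (\<alpha> - 1) * \<phi> t)) {0..1}"
proof -
  have "((\<lambda>t. \<alpha> * (t powr (\<alpha> - 1) * \<phi> t) + t powr \<alpha> * \<phi>' t) has_integral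
      1 powr \<alpha> * \<phi> 1 - 0 powr \<alpha> * \<phi> 0) {0..1}"
  proof (rule fundamental_theorem_of_calculus_interior)
    show "continuous_on {0..1} (\<lambda>t. t powr \<alpha> * \<phi> t)"
      using \<alpha> by (intro continuous_on_mult cont continuous_on_powr') (auto intro!: continuous_intros)
    show "((\<lambda>t. t powr \<alpha> * \<phi> t) has_vector_derivative
        \<alpha> * (t powr (\<alpha> - 1) * \<phi> t) + t powr \<alpha> * \<phi>' t) (at t)" if "t \<in> {0<..<1}" for t
      using DERIV_mult[OF has_real_derivative_powr[of t \<alpha>] deriv[OF that]] that
      by (simp add: has_real_derivative_iff_has_vector_derivative algebra_simps)
  qed simp
  from has_integral_diff[OF this] have "((\<lambda>t. \<alpha> * (t powr (\<alpha> - 1) * \<phi> t)) has_integral X) {0..1}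
      \<Longrightarrow> ((\<lambda>t. t powr \<alpha> * \<phi>' t) has_integral \<phi> 1 - X) {0..1}" for X
    by force
  moreover have "((\<lambda>t. \<alpha> * (t powr (\<alpha> - 1) * \<phi> t)) has_integral
      \<alpha> * (LBINT t:{0..1}. t powr (\<alpha> - 1) * \<phi> t)) {0..1}"
    using set_borel_integral_eq_integral[OF set_integrable_powr_mult_continuous[OF \<alpha> cont]]
    by (intro has_integral_mult_right) (simp add: has_integral_iff)
  ultimately show ?thesis
    by blast
qed

section \<open>The harmonic path\<close>

text \<open>With \<open>c \<in> {a, b}\<close>, \<open>1 / harmonic_path c x t\<close> is the segment from \<open>1 / c\<close> to \<open>1 / x\<close>:
  this parametrisation serves both fractional integrals at once.\<close>
definition harmonic_path :: "real \<Rightarrow> real \<Rightarrow> real \<Rightarrow> real" where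
  "harmonic_path c x t = c * x / (t * c + (1 - t) * x)"

lemma convex_comb_pos:
  fixes c x t :: real
  assumes "c > 0" "x > 0" "t \<in> {0..1}"
  shows "t * c + (1 - t) * x > 0"
  using assms convex_bound_lt[of "-c" 0 "-x" t "1 - t"] by simp

text \<open>The denominator is a convex combination of \<open>c\<close> and \<open>x\<close>, so it
  lies between \<open>min c x\<close> and \<open>max c x\<close>. As \<open>c * x\<close> is the
  product of these two, so does the quotient.\<close>

lemma harmonic_path_bounds:
  assumes "c > 0" "x > 0" "t \<in> {0..1}"
  shows "harmonic_path c x t \<in> {min c x..max c x}"
proof -
  let ?D = "t * c + (1 - t) * x"
  have D: "?D > 0" using assms by (rule convex_comb_pos)
  have min: "min c x \<le> ?D"
    using assms convex_bound_le[of "- c" "- min c x" "- x" t "1 - t"] by (simp add: algebra_simps)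
  have max: "?D \<le> max c x"
    using assms convex_bound_le[of "c" "max c x" "x" t "1 - t"] by (simp add: algebra_simps)
  have cx: "c * x = min c x * max c x" by (simp add: min_def max_def)
  have "min c x * ?D \<le> min c x * max c x" using max assms by (intro mult_left_mono) auto
  moreover have "min c x * max c x \<le> ?D * max c x" using min assms by (intro mult_right_mono) auto
  ultimately show ?thesis
    unfolding harmonic_path_def cx using D by (simp add: field_simps)
qed

text \<open>The path meets \<open>c\<close> only where its denominator is \<open>x\<close>, and
  \<open>x\<close> only where it is \<open>c\<close>. Strictness allows the chain rule where
  \<open>f\<close> has a two-sided derivative on the open interval only.\<close>

lemma harmonic_path_bounds_strict:
  assumes "c > 0" "x > 0" "t \<in> {0<..<1}" "c \<noteq> x"
  shows "harmonic_path c x t \<in> {min c x<..<max c x}"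
proof -
  let ?D = "t * c + (1 - t) * x"
  have D: "?D > 0" using assms by (intro convex_comb_pos) auto
  have "?D - x = t * (c - x)" "?D - c = (1 - t) * (x - c)" by (simp_all add: algebra_simps)
  then have "?D \<noteq> x" "?D \<noteq> c" using assms by auto
  then have "harmonic_path c x t \<noteq> c" "harmonic_path c x t \<noteq> x"
    using D assms(1,2) by (auto simp: harmonic_path_def divide_eq_eq)
  then show ?thesis
    using harmonic_path_bounds[of c x t] assms by (auto simp: min_def max_def split: if_splits)
qed

lemma continuous_on_harmonic_path:
  assumes "c > 0" "x > 0"
  shows "continuous_on {0..1} (harmonic_path c x)"
  unfolding harmonic_path_def
  by (intro continuous_intros) (use convex_comb_pos[OF assms] in force)

lemma harmonic_path_has_real_derivative:
  assumes "c > 0" "x > 0" "t \<in> {0..1}"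
  shows "(harmonic_path c x has_real_derivative
    c * x * (x - c) / (t * c + (1 - t) * x)\<^sup>2) (at t)"
  unfolding harmonic_path_def using convex_comb_pos[OF assms]
  by (auto intro!: derivative_eq_intros simp: power2_eq_square algebra_simps)

section \<open>Fractional integrals along the path\<close>

text \<open>Here \<open>d\<close> is the length of the segment and \<open>e\<close> its orientation,
  so \<open>e * (w - 1 / c)\<close> is the distance of \<open>w\<close> from \<open>1 / c\<close>.
  Under \<open>w = 1 / c + e * d * t\<close> this distance is \<open>d * t\<close>, and the Jacobian
  raises \<open>d powr (\<alpha> - 1)\<close> to \<open>d powr \<alpha>\<close>.\<close>

lemma LBINT_powr_segment_eq_path:
  assumes "c > 0" "x > 0" and d: "d > 0" and e: "\<bar>e\<bar> = 1" "e * d = 1 / x - 1 / c"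
  shows "(LBINT w:{min (1 / c) (1 / x)..max (1 / c) (1 / x)}. (e * (w - 1 / c)) powr (\<alpha> - 1) * f (1 / w))
    = d powr \<alpha> * (LBINT t:{0..1}. t powr (\<alpha> - 1) * f (harmonic_path c x t))"
proof -
  have e2: "e * e = 1" using e(1) by (metis abs_mult_self_eq mult_1)
  have "e \<noteq> 0" using e(1) by auto
  then have ed: "e * d \<noteq> 0" "\<bar>e * d\<bar> = d" "1 / c + e * d = 1 / x"
    using d e(1) by (simp_all add: abs_mult) (simp add: e(2))
  have "(LBINT w:{min (1 / c) (1 / x)..max (1 / c) (1 / x)}. (e * (w - 1 / c)) powr (\<alpha> - 1) * f (1 / w))
      = d * (LBINT t:{0..1}. (e * (1 / c + e * d * t - 1 / c)) powr (\<alpha> - 1) * f (1 / (1 / c + e * d * t)))"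
    by (rule LBINT_affine_unit[OF ed(1), of "1 / c" "\<lambda>w. (e * (w - 1 / c)) powr (\<alpha> - 1) * f (1 / w)",
          unfolded ed(2,3)])
  also have "(LBINT t:{0..1}. (e * (1 / c + e * d * t - 1 / c)) powr (\<alpha> - 1) * f (1 / (1 / c + e * d * t)))
      = (LBINT t:{0..1}. d powr (\<alpha> - 1) * (t powr (\<alpha> - 1) * f (harmonic_path c x t)))"
  proof (intro set_lebesgue_integral_cong allI impI)
    fix t :: real assume t: "t \<in> {0..1}"
    \<comment> \<open>The point of the segment at parameter \<open>t\<close> is the reciprocal of
      \<open>harmonic_path c x t\<close>.\<close>
    have "1 / c + e * d * t = (t * c + (1 - t) * x) / (c * x)"
      unfolding e(2) using assms(1,2) by (simp add: field_simps)
    moreover have "e * (1 / c + e * d * t - 1 / c) = d * t"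
      using e2 by (simp flip: mult.assoc)
    ultimately show "(e * (1 / c + e * d * t - 1 / c)) powr (\<alpha> - 1) * f (1 / (1 / c + e * d * t))
        = d powr (\<alpha> - 1) * (t powr (\<alpha> - 1) * f (harmonic_path c x t))"
      using d t by (simp add: harmonic_path_def powr_mult)
  qed simp
  also have "d * \<dots> = d powr \<alpha> * (LBINT t:{0..1}. t powr (\<alpha> - 1) * f (harmonic_path c x t))"
  proof -
    have "d * d powr (\<alpha> - 1) = d powr \<alpha>" using d by (simp add: powr_diff)
    then show ?thesis unfolding set_integral_mult_right by (metis mult.assoc)
  qed
  finally show ?thesis .
qed

lemma Gamma_plus1_div_Gamma:
  fixes \<alpha> :: real
  assumes "\<alpha> > 0"
  shows "Gamma (\<alpha> + 1) * (1 / Gamma \<alpha> * X) = \<alpha> * X"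
proof -
  have "Gamma (\<alpha> + 1) = \<alpha> * Gamma \<alpha>"
    using assms by (intro Gamma_plus1) (auto elim!: nonpos_Ints_cases)
  then show ?thesis
    using Gamma_real_pos[OF assms, THEN less_imp_neq] by auto
qed

text \<open>For \<open>c < x\<close> the point \<open>1 / c\<close> is the right end of the segment,
  so the orientation is \<open>-1\<close>; this is the case \<open>c = a\<close>. The mirror case
  \<open>c = b\<close> has orientation \<open>1\<close>.\<close>

lemma RL_plus_eq_path:
  assumes "\<alpha> > 0" "0 < c" "c < x"
  shows "Gamma (\<alpha> + 1) * RL_plus \<alpha> (1 / x) (f \<circ> (\<lambda>u. 1 / u)) (1 / c) =
    (\<bar>x - c\<bar> / (c * x)) powr \<alpha> * (\<alpha> * (LBINT t:{0..1}. t powr (\<alpha> - 1) * f (harmonic_path c x t)))"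
proof -
  have mm: "min (1 / c) (1 / x) = 1 / x" "max (1 / c) (1 / x) = 1 / c"
    using assms by (auto simp: min_def max_def field_simps)
  have "-1 * (\<bar>x - c\<bar> / (c * x)) = 1 / x - 1 / c" "\<bar>x - c\<bar> / (c * x) > 0" "x > 0"
    using assms by (auto simp: field_simps)
  then show ?thesis
    unfolding RL_plus_def Gamma_plus1_div_Gamma[OF assms(1)]
    using LBINT_powr_segment_eq_path[of c x "\<bar>x - c\<bar> / (c * x)" "-1" \<alpha> f, unfolded mm] assms by simp
qed

lemma RL_minus_eq_path:
  assumes "\<alpha> > 0" "0 < x" "x < c"
  shows "Gamma (\<alpha> + 1) * RL_minus \<alpha> (1 / x) (f \<circ> (\<lambda>u. 1 / u)) (1 / c) =
    (\<bar>x - c\<bar> / (c * x)) powr \<alpha> * (\<alpha> * (LBINT t:{0..1}. t powr (\<alpha> - 1) * f (harmonic_path c x t)))"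
proof -
  have mm: "min (1 / c) (1 / x) = 1 / c" "max (1 / c) (1 / x) = 1 / x"
    using assms by (auto simp: min_def max_def field_simps)
  have "1 * (\<bar>x - c\<bar> / (c * x)) = 1 / x - 1 / c" "\<bar>x - c\<bar> / (c * x) > 0" "c > 0"
    using assms by (auto simp: field_simps)
  then show ?thesis
    unfolding RL_minus_def Gamma_plus1_div_Gamma[OF assms(1)]
    using LBINT_powr_segment_eq_path[of c x "\<bar>x - c\<bar> / (c * x)" "1" \<alpha> f, unfolded mm] assms by simp
qed

section \<open>Euler integrals of the four \<lambda>s\<close>

text \<open>The Beta factor in each \<lambda> is exactly the normalisation of its hypergeometric
  function; it is nonzero for positive arguments and cancels.\<close>

lemma Beta_mult_hypergeometric_2F1:
  assumes "B > 0" "E > 0"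
  shows "Beta B E * hypergeometric_2F1 A B (B + E) z =
    (LBINT t:{0..1}. t powr (B - 1) * (1 - t) powr (E - 1) * (1 - z * t) powr (- A))"
  using Gamma_real_pos[of B, THEN less_imp_neq] Gamma_real_pos[of E, THEN less_imp_neq]
    Gamma_real_pos[of "B + E", THEN less_imp_neq] assms
  by (auto simp: hypergeometric_2F1_def Beta_def)

text \<open>Since \<open>x * (1 - (1 - c / x) * t) = t * c + (1 - t) * x\<close>, the prefactor of
  each \<lambda> is absorbed into the base of the kernel.\<close>

lemma LBINT_kernel_scale:
  fixes c x \<theta> :: real
  assumes "c > 0" "x > 0"
  shows "(LBINT t:{0..1}. h t * (1 - (1 - c / x) * t) powr (- (2 * \<theta>))) / x powr (2 * \<theta>)
    = (LBINT t:{0..1}. h t * (t * c + (1 - t) * x) powr (- (2 * \<theta>)))"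
proof -
  have "h t * (1 - (1 - c / x) * t) powr (- (2 * \<theta>)) / x powr (2 * \<theta>)
      = h t * (t * c + (1 - t) * x) powr (- (2 * \<theta>))" if "t \<in> {0..1}" for t
  proof -
    define E where "E = 1 - (1 - c / x) * t"
    have eq: "t * c + (1 - t) * x = x * E"
      using assms by (simp add: E_def field_simps)
    then have "E > 0"
      using convex_comb_pos[OF assms that] assms by (simp add: zero_less_mult_iff)
    then show ?thesis
      unfolding eq E_def[symmetric] using assms by (simp add: powr_mult powr_minus_divide)
  qed
  then show ?thesis
    unfolding set_integral_divide_zero[symmetric] by (intro set_lebesgue_integral_cong) auto
qed

text \<open>The factor \<open>(1 - t) powr 0\<close> is kept so that all four \<lambda>s share one
  shape, with exponents \<open>\<rho> + s\<close> and \<open>0\<close> for \<open>lambda1\<close>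
  and \<open>lambda3\<close>, \<open>\<rho>\<close> and \<open>s\<close> for \<open>lambda2\<close>
  and \<open>lambda4\<close>.\<close>

lemma lambda1_eq:
  assumes "c > 0" "x > 0" "\<rho> + s + 1 > 0"
  shows "lambda1 c x s \<theta> \<rho> =
    (LBINT t:{0..1}. t powr (\<rho> + s) * (1 - t) powr 0 * (t * c + (1 - t) * x) powr (- (2 * \<theta>)))"
proof -
  have "lambda1 c x s \<theta> \<rho> = (LBINT t:{0..1}. t powr (\<rho> + s) * (1 - t) powr 0
      * (1 - (1 - c / x) * t) powr (- (2 * \<theta>))) / x powr (2 * \<theta>)"
    using Beta_mult_hypergeometric_2F1[of "\<rho> + s + 1" 1 "2 * \<theta>" "1 - c / x"] assms
    by (simp add: lambda1_def add.assoc)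
  then show ?thesis
    using LBINT_kernel_scale[OF assms(1,2)] by simp
qed

lemma lambda2_eq:
  assumes "c > 0" "x > 0" "\<rho> + 1 > 0" "s + 1 > 0"
  shows "lambda2 c x s \<theta> \<rho> =
    (LBINT t:{0..1}. t powr \<rho> * (1 - t) powr s * (t * c + (1 - t) * x) powr (- (2 * \<theta>)))"
proof -
  have "lambda2 c x s \<theta> \<rho> = (LBINT t:{0..1}. t powr \<rho> * (1 - t) powr s
      * (1 - (1 - c / x) * t) powr (- (2 * \<theta>))) / x powr (2 * \<theta>)"
    using Beta_mult_hypergeometric_2F1[of "\<rho> + 1" "s + 1" "2 * \<theta>" "1 - c / x"] assms
    by (simp add: lambda2_def algebra_simps)
  then show ?thesis
    using LBINT_kernel_scale[OF assms(1,2)] by simp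
qed

text \<open>The roles of \<open>c\<close> and \<open>x\<close> are swapped against
  \<open>lambda1\<close>; for \<open>x \<le> c\<close> this keeps the argument
  \<open>1 - x / c\<close> in the range of Euler's formula. The reflection of the unit interval
  undoes the swap and gives the integral of \<open>lambda1\<close>.\<close>

lemma lambda3_eq:
  assumes "c > 0" "x > 0" "\<rho> + s + 1 > 0"
  shows "lambda3 c x s \<theta> \<rho> =
    (LBINT t:{0..1}. t powr (\<rho> + s) * (1 - t) powr 0 * (t * c + (1 - t) * x) powr (- (2 * \<theta>)))"
proof -
  have "lambda3 c x s \<theta> \<rho> = (LBINT t:{0..1}. t powr 0 * (1 - t) powr (\<rho> + s)
      * (1 - (1 - x / c) * t) powr (- (2 * \<theta>))) / c powr (2 * \<theta>)"
    using Beta_mult_hypergeometric_2F1[of 1 "\<rho> + s + 1" "2 * \<theta>" "1 - x / c"] assms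
    by (simp add: lambda3_def algebra_simps)
  also have "\<dots> = (LBINT t:{0..1}. t powr 0 * (1 - t) powr (\<rho> + s)
      * (t * x + (1 - t) * c) powr (- (2 * \<theta>)))"
    by (rule LBINT_kernel_scale[OF assms(2,1)])
  finally show ?thesis
    by (subst LBINT_reflect_unit[symmetric]) (simp add: mult_ac add.commute)
qed

lemma lambda4_eq:
  assumes "c > 0" "x > 0" "\<rho> + 1 > 0" "s + 1 > 0"
  shows "lambda4 c x s \<theta> \<rho> =
    (LBINT t:{0..1}. t powr \<rho> * (1 - t) powr s * (t * c + (1 - t) * x) powr (- (2 * \<theta>)))"
proof -
  have "lambda4 c x s \<theta> \<rho> = (LBINT t:{0..1}. t powr s * (1 - t) powr \<rho>
      * (1 - (1 - x / c) * t) powr (- (2 * \<theta>))) / c powr (2 * \<theta>)"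
    using Beta_mult_hypergeometric_2F1[of "s + 1" "\<rho> + 1" "2 * \<theta>" "1 - x / c"] assms
    by (simp add: lambda4_def algebra_simps)
  also have "\<dots> = (LBINT t:{0..1}. t powr s * (1 - t) powr \<rho>
      * (t * x + (1 - t) * c) powr (- (2 * \<theta>)))"
    by (rule LBINT_kernel_scale[OF assms(2,1)])
  finally show ?thesis
    by (subst LBINT_reflect_unit[symmetric]) (simp add: mult_ac add.commute)
qed

text \<open>The factor \<open>(1 - t) powr 0\<close> vanishes at \<open>t = 1\<close>, as \<open>0 powr 0 = 0\<close>; hence the spike.\<close>
lemma kernel_has_integral:
  fixes c x i j \<theta> :: real
  assumes "c > 0" "x > 0" "i > 0" "j \<ge> 0"
  defines "k \<equiv> \<lambda>t. t powr i * (if j = 0 then 1 else (1 - t) powr j)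
      * (t * c + (1 - t) * x) powr (- (2 * \<theta>))"
  shows "(k has_integral (LBINT t:{0..1}. t powr i * (1 - t) powr j
      * (t * c + (1 - t) * x) powr (- (2 * \<theta>)))) {0..1}"
proof -
  have "continuous_on {0..1} (\<lambda>t. (1 - t) powr j)" if "j \<noteq> 0"
    using that assms by (intro continuous_on_powr') (auto intro!: continuous_intros)
  then have "continuous_on {0..1} (\<lambda>t. if j = 0 then 1 else (1 - t) powr j)"
    by (cases "j = 0") auto
  moreover have "continuous_on {0..1} (\<lambda>t. t powr i)"
    using assms by (intro continuous_on_powr') (auto intro!: continuous_intros)
  moreover have "continuous_on {0..1} (\<lambda>t. (t * c + (1 - t) * x) powr (- (2 * \<theta>)))"
    using convex_comb_pos[OF assms(1,2)]
    by (intro continuous_on_powr') (force intro!: continuous_intros)+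
  ultimately have "continuous_on {0..1} k"
    unfolding k_def by (intro continuous_on_mult)
  then have int: "set_integrable lborel {0..1} k"
    by (rule borel_integrable_atLeastAtMost')
  have "(LBINT t:{0..1}. t powr i * (1 - t) powr j
      * (t * c + (1 - t) * x) powr (- (2 * \<theta>))) = (LBINT t:{0..1}. k t)"
    unfolding k_def
  proof (rule set_lebesgue_integral_cong_AE)
    show "AE t\<in>{0..1} in lborel. t powr i * (1 - t) powr j * (t * c + (1 - t) * x) powr (- (2 * \<theta>))
        = t powr i * (if j = 0 then 1 else (1 - t) powr j) * (t * c + (1 - t) * x) powr (- (2 * \<theta>))"
      using AE_lborel_singleton[of 1] by eventually_elim auto
  qed auto
  then show ?thesis
    using set_borel_integral_eq_integral[OF int] by (simp add: has_integral_iff)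
qed

section \<open>The estimate for one endpoint\<close>

text \<open>The difference on the left is \<open>k\<close> times the integral of
  \<open>\<phi>\<close>, by parts along the path. Since \<open>c\<close> may lie on either side of
  \<open>x\<close>, both halves of \<open>S_frac\<close> are covered; the integrals \<open>H\<close>
  are those of the \<lambda>s.\<close>

lemma abs_path_by_parts_le:
  fixes f f' :: "real \<Rightarrow> real" and c x \<alpha> s q :: real
  defines "H \<equiv> \<lambda>i j. LBINT t:{0..1}. t powr i * (1 - t) powr j
      * (t * c + (1 - t) * x) powr (- (2 * q))"
  assumes c: "c > 0" and x: "x > 0" and cx: "c \<noteq> x"
    and cont: "continuous_on {min c x..max c x} f"
    and deriv: "\<And>u. u \<in> {min c x<..<max c x} \<Longrightarrow> (f has_real_derivative f' u) (at u)"
    and \<alpha>: "\<alpha> > 0" and s: "0 < s" and q: "q \<ge> 1"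
    and conv: "\<And>t. t \<in> {0..1} \<Longrightarrow> \<bar>f' (harmonic_path c x t)\<bar> powr q
        \<le> t powr s * \<bar>f' x\<bar> powr q + (1 - t) powr s * \<bar>f' c\<bar> powr q"
  shows "(\<bar>x - c\<bar> / (c * x)) powr \<alpha>
      * \<bar>f x - \<alpha> * (LBINT t:{0..1}. t powr (\<alpha> - 1) * f (harmonic_path c x t))\<bar>
    \<le> \<bar>x - c\<bar> powr (\<alpha> + 1) / (c * x) powr (\<alpha> - 1)
      * (H (\<alpha> * q + s) 0 * \<bar>f' x\<bar> powr q + H (\<alpha> * q) s * \<bar>f' c\<bar> powr q) powr (1 / q)"
proof -
  define D where "D = (\<lambda>t. t * c + (1 - t) * x)"
  define J where "J = f x - \<alpha> * (LBINT t:{0..1}. t powr (\<alpha> - 1) * f (harmonic_path c x t))"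
  define \<phi> where "\<phi> = (\<lambda>t. t powr \<alpha> * (f' (harmonic_path c x t) / (D t)\<^sup>2))"
  \<comment> \<open>The numerator of the derivative of the path; it does not depend on
    \<open>t\<close> and divides out of the integral.\<close>
  define k where "k = c * x * (x - c)"
  have k: "k \<noteq> 0" using c x cx by (simp add: k_def)
  have D: "D t > 0" if "t \<in> {0..1}" for t
    using convex_comb_pos[OF c x that] by (simp add: D_def)
  have "((\<lambda>t. t powr \<alpha> * (f' (harmonic_path c x t) * (k / (D t)\<^sup>2))) has_integral
      f (harmonic_path c x 1)
      - \<alpha> * (LBINT t:{0..1}. t powr (\<alpha> - 1) * f (harmonic_path c x t))) {0..1}"
  proof (rule powr_mult_derivative_has_integral[OF \<alpha>, where \<phi> = "\<lambda>t. f (harmonic_path c x t)"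
        and \<phi>' = "\<lambda>t. f' (harmonic_path c x t) * (k / (D t)\<^sup>2)"])
    show "continuous_on {0..1} (\<lambda>t. f (harmonic_path c x t))"
      using harmonic_path_bounds[OF c x]
      by (intro continuous_on_compose2[OF cont continuous_on_harmonic_path[OF c x]]) auto
    show "((\<lambda>t. f (harmonic_path c x t)) has_real_derivative
        f' (harmonic_path c x t) * (k / (D t)\<^sup>2)) (at t)" if t: "t \<in> {0<..<1}" for t
    proof (rule DERIV_chain2[where f = f and g = "harmonic_path c x"])
      show "(f has_real_derivative f' (harmonic_path c x t)) (at (harmonic_path c x t))"
        using harmonic_path_bounds_strict[OF c x t cx] by (rule deriv)
      show "(harmonic_path c x has_real_derivative k / (D t)\<^sup>2) (at t)"
        using harmonic_path_has_real_derivative[OF c x, of t] t by (simp add: D_def k_def)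
    qed
  qed
  \<comment> \<open>The path ends in \<open>harmonic_path c x 1 = x\<close>, so the integral equals
    \<open>J\<close>.\<close>
  then have "((\<lambda>t. (1 / k) * (t powr \<alpha> * (f' (harmonic_path c x t) * (k / (D t)\<^sup>2))))
      has_integral (1 / k) * J) {0..1}"
    using c by (intro has_integral_mult_right) (simp add: J_def harmonic_path_def)
  then have \<phi>: "(\<phi> has_integral (1 / k) * J) {0..1}"
    using k by (simp add: \<phi>_def mult_ac)
  \<comment> \<open>The first summand has \<open>1\<close> in place of
    \<open>(1 - t) powr 0\<close>: the latter is \<open>0\<close> at \<open>t = 1\<close>, where the
    pointwise bound must hold as well.\<close>
  define \<psi> where "\<psi> = (\<lambda>t.
      t powr (\<alpha> * q + s) * 1 * D t powr (- (2 * q)) * \<bar>f' x\<bar> powr q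
      + t powr (\<alpha> * q) * (1 - t) powr s * D t powr (- (2 * q)) * \<bar>f' c\<bar> powr q)"
  have "\<alpha> * q > 0" using \<alpha> q by simp
  then have \<psi>: "(\<psi> has_integral H (\<alpha> * q + s) 0 * \<bar>f' x\<bar> powr q + H (\<alpha> * q) s * \<bar>f' c\<bar> powr q) {0..1}"
    unfolding \<psi>_def H_def D_def
    using kernel_has_integral[OF c x, of "\<alpha> * q + s" 0 q] kernel_has_integral[OF c x, of "\<alpha> * q" s q] s
    by (intro has_integral_add has_integral_mult_left) auto
  have "\<bar>(1 / k) * J\<bar> \<le> (H (\<alpha> * q + s) 0 * \<bar>f' x\<bar> powr q + H (\<alpha> * q) s * \<bar>f' c\<bar> powr q) powr (1 / q)"
  proof (rule abs_integral_le_powr[OF \<phi> \<psi> _ q])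
    fix t :: real assume t: "t \<in> {0..1}"
    have "((D t)\<^sup>2) powr q = D t powr (2 * q)"
      using D[OF t] by (simp add: powr_powr flip: powr_numeral)
    then have D2: "(1 / (D t)\<^sup>2) powr q = D t powr (- (2 * q))"
      by (simp add: powr_divide powr_minus_divide)
    have "\<bar>\<phi> t\<bar> = t powr \<alpha> * (1 / (D t)\<^sup>2) * \<bar>f' (harmonic_path c x t)\<bar>"
      by (simp add: \<phi>_def abs_mult)
    then have "\<bar>\<phi> t\<bar> powr q
        = t powr (\<alpha> * q) * D t powr (- (2 * q)) * \<bar>f' (harmonic_path c x t)\<bar> powr q"
      by (simp only: powr_mult powr_powr D2)
    also have "\<dots> \<le> t powr (\<alpha> * q) * D t powr (- (2 * q))
        * (t powr s * \<bar>f' x\<bar> powr q + (1 - t) powr s * \<bar>f' c\<bar> powr q)"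
      using conv[OF t] by (intro mult_left_mono) auto
    also have "\<dots> = \<psi> t" by (simp add: \<psi>_def powr_add algebra_simps)
    finally show "\<bar>\<phi> t\<bar> powr q \<le> \<psi> t" .
  qed
  then have "\<bar>k\<bar> * \<bar>(1 / k) * J\<bar> \<le> \<bar>k\<bar> * (H (\<alpha> * q + s) 0 * \<bar>f' x\<bar> powr q + H (\<alpha> * q) s * \<bar>f' c\<bar> powr q) powr (1 / q)"
    by (intro mult_left_mono) auto
  moreover have "\<bar>k\<bar> * \<bar>(1 / k) * J\<bar> = \<bar>J\<bar>"
    using k by (simp add: abs_mult)
  ultimately have "(\<bar>x - c\<bar> / (c * x)) powr \<alpha> * \<bar>J\<bar> \<le> (\<bar>x - c\<bar> / (c * x)) powr \<alpha> *
      (\<bar>k\<bar> * (H (\<alpha> * q + s) 0 * \<bar>f' x\<bar> powr q + H (\<alpha> * q) s * \<bar>f' c\<bar> powr q) powr (1 / q))"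
    by (intro mult_left_mono) (auto simp only: powr_ge_zero)
  \<comment> \<open>One factor \<open>\<bar>x - c\<bar>\<close> of \<open>\<bar>k\<bar>\<close>
    raises the exponent of the numerator, and its factor \<open>c * x\<close> lowers that of the
    denominator.\<close>
  moreover have "(\<bar>x - c\<bar> / (c * x)) powr \<alpha> * \<bar>k\<bar> = \<bar>x - c\<bar> powr (\<alpha> + 1) / (c * x) powr (\<alpha> - 1)"
    using c x cx by (simp add: k_def abs_mult powr_divide powr_add powr_diff)
  ultimately show ?thesis
    unfolding J_def by (simp only: mult.assoc[symmetric])
qed

section \<open>The bound for \<open>S_frac\<close> from its two halves\<close>

theorem theorem8:
  fixes I :: "real set" and f f' :: "real \<Rightarrow> real" and a b \<alpha> s q :: real
  assumes "is_interval I" and "I \<subseteq> {0<..}"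
    and "\<And>u. u \<in> interior I \<Longrightarrow> (f has_real_derivative f' u) (at u)"
    and "a \<in> I" and "b \<in> I" and "a < b"
    and "\<And>u. u \<in> {a, b} \<Longrightarrow> (f has_real_derivative f' u) (at u within I)"
    and "f' absolutely_integrable_on {a..b}"
    and "\<alpha> > 0" and "0 < s" and "s \<le> 1" and "q \<ge> 1"
    and "harmonically_s_convex_on s {a..b} (\<lambda>u. \<bar>f' u\<bar> powr q)"
  shows "\<forall>x\<in>{a..b}.
    \<bar>S_frac f (\<lambda>u. 1 / u) \<alpha> x a b\<bar>
      \<le> (x - a) powr (\<alpha> + 1) / (a * x) powr (\<alpha> - 1)
          * (lambda1 a x s q (\<alpha> * q) * \<bar>f' x\<bar> powr q
             + lambda2 a x s q (\<alpha> * q) * \<bar>f' a\<bar> powr q) powr (1 / q)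
        + (b - x) powr (\<alpha> + 1) / (b * x) powr (\<alpha> - 1)
          * (lambda3 b x s q (\<alpha> * q) * \<bar>f' x\<bar> powr q
             + lambda4 b x s q (\<alpha> * q) * \<bar>f' b\<bar> powr q) powr (1 / q)"
proof
  note I = assms(1) and Ipos = assms(2) and deriv = assms(3) and aI = assms(4) and bI = assms(5)
    and ab = assms(6) and deriv_end = assms(7) and \<alpha> = assms(9) and s = assms(10) and q = assms(12)
    and conv = assms(13)
  fix x assume xab: "x \<in> {a..b}"
  have a: "a > 0" using Ipos aI by auto
  have x: "x > 0" and b: "b > 0" using a ab xab by auto
  have sub: "{a..b} \<subseteq> I"
    using mem_is_interval_1_I[OF I aI bI] by auto
  then have int: "{a<..<b} \<subseteq> interior I"
    by (intro interior_maximal) auto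
  have deriv': "(f has_real_derivative f' u) (at u)" if "u \<in> {a<..<b}" for u
    using deriv int that by blast
  \<comment> \<open>Integration by parts needs continuity up to the ends of the path. At
    \<open>a\<close> and \<open>b\<close>, which may be boundary points of \<open>I\<close>, it
    comes from the derivative within \<open>I\<close>.\<close>
  have cont: "continuous_on {a..b} f"
    unfolding continuous_on_eq_continuous_within
  proof
    fix u assume u: "u \<in> {a..b}"
    then have "(f has_real_derivative f' u) (at u within {a..b})"
    proof (cases "u \<in> {a, b}")
      case True
      then show ?thesis using has_field_derivative_subset[OF deriv_end[OF True] sub] by simp
    next
      case False
      with u have "u \<in> {a<..<b}" by auto
      then show ?thesis by (intro has_field_derivative_at_within[OF deriv'])
    qed
    then show "continuous (at u within {a..b}) f" by (rule DERIV_continuous)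
  qed
  \<comment> \<open>Harmonic convexity with \<open>u = c\<close> and \<open>v = x\<close>: its
    intermediate point is \<open>harmonic_path c x t\<close>.\<close>
  have conv': "\<bar>f' (harmonic_path c x t)\<bar> powr q
      \<le> t powr s * \<bar>f' x\<bar> powr q + (1 - t) powr s * \<bar>f' c\<bar> powr q"
    if "c \<in> {a..b}" "t \<in> {0..1}" for c t
    using conv[unfolded harmonically_s_convex_on_def, THEN conjunct2, THEN conjunct2,
        THEN bspec[OF _ that(1)], THEN bspec[OF _ xab], THEN bspec[OF _ that(2)]]
    by (simp only: harmonic_path_def)
  \<comment> \<open>The half of \<open>S_frac\<close> that belongs to the endpoint \<open>c\<close>;
    it vanishes for \<open>c = x\<close>, as does its bound.\<close>
  define T where "T = (\<lambda>c. (\<bar>x - c\<bar> / (c * x)) powr \<alpha>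
      * (f x - \<alpha> * (LBINT t:{0..1}. t powr (\<alpha> - 1) * f (harmonic_path c x t))))"
  have half: "\<bar>T c\<bar> \<le> \<bar>x - c\<bar> powr (\<alpha> + 1) / (c * x) powr (\<alpha> - 1)
      * ((LBINT t:{0..1}. t powr (\<alpha> * q + s) * (1 - t) powr 0
            * (t * c + (1 - t) * x) powr (- (2 * q))) * \<bar>f' x\<bar> powr q
         + (LBINT t:{0..1}. t powr (\<alpha> * q) * (1 - t) powr s
            * (t * c + (1 - t) * x) powr (- (2 * q))) * \<bar>f' c\<bar> powr q) powr (1 / q)"
    if c: "c \<in> {a..b}" for c
  proof (cases "c = x")
    case True
    then show ?thesis using \<alpha> by (simp add: T_def)
  next
    case False
    have "c > 0" using a c by simp
    have "{min c x..max c x} \<subseteq> {a..b}"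
      using c xab by auto
    then have cont': "continuous_on {min c x..max c x} f"
      by (rule continuous_on_subset[OF cont])
    have deriv'': "(f has_real_derivative f' u) (at u)" if "u \<in> {min c x<..<max c x}" for u
      using c xab that by (intro deriv') auto
    show ?thesis
      using abs_path_by_parts_le[OF \<open>c > 0\<close> x False cont' deriv'' \<alpha> s q conv'[OF c]]
      by (simp only: T_def abs_mult abs_of_nonneg[OF powr_ge_zero])
  qed
  have "((x - a) / (a * x)) powr \<alpha> * f x
      - Gamma (\<alpha> + 1) * RL_plus \<alpha> (1 / x) (f \<circ> (\<lambda>u. 1 / u)) (1 / a) = T a"
  proof (cases "a = x")
    case True
    then show ?thesis using \<alpha> by (simp add: T_def RL_plus_def LBINT_singleton)
  next
    case False
    then show ?thesis
      using RL_plus_eq_path[OF \<alpha> a, of x f] xab by (simp add: T_def right_diff_distrib)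
  qed
  moreover have "((b - x) / (b * x)) powr \<alpha> * f x
      - Gamma (\<alpha> + 1) * RL_minus \<alpha> (1 / x) (f \<circ> (\<lambda>u. 1 / u)) (1 / b) = T b"
  proof (cases "b = x")
    case True
    then show ?thesis using \<alpha> by (simp add: T_def RL_minus_def LBINT_singleton)
  next
    case False
    then show ?thesis
      using RL_minus_eq_path[OF \<alpha> x, of b f] xab by (simp add: T_def right_diff_distrib)
  qed
  ultimately have S: "S_frac f (\<lambda>u. 1 / u) \<alpha> x a b = T a + T b"
    unfolding S_frac_def by (simp add: algebra_simps)
  have "\<alpha> * q > 0" using \<alpha> q by simp
  then have pos: "\<alpha> * q + s + 1 > 0" "\<alpha> * q + 1 > 0" "s + 1 > 0" using s by auto
  show "\<bar>S_frac f (\<lambda>u. 1 / u) \<alpha> x a b\<bar>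
      \<le> (x - a) powr (\<alpha> + 1) / (a * x) powr (\<alpha> - 1)
          * (lambda1 a x s q (\<alpha> * q) * \<bar>f' x\<bar> powr q
             + lambda2 a x s q (\<alpha> * q) * \<bar>f' a\<bar> powr q) powr (1 / q)
        + (b - x) powr (\<alpha> + 1) / (b * x) powr (\<alpha> - 1)
          * (lambda3 b x s q (\<alpha> * q) * \<bar>f' x\<bar> powr q
             + lambda4 b x s q (\<alpha> * q) * \<bar>f' b\<bar> powr q) powr (1 / q)"
    \<comment> \<open>In integral form the \<lambda>s of \<open>a\<close> and of \<open>b\<close>
      have the same shape, so \<open>half\<close> applies to both endpoints.\<close>
    unfolding S lambda1_eq[OF a x pos(1)] lambda2_eq[OF a x pos(2,3)]
      lambda3_eq[OF b x pos(1)] lambda4_eq[OF b x pos(2,3)]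
    using half[of a] half[of b] xab ab
    by (intro order_trans[OF abs_triangle_ineq add_mono]) auto
qed

end
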